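(* Let $m$ be an odd positive integer. Then $$Z_{2m}(x) = Z_m(x)\, Z_m(-\Phi_2(x)) = Z_m(x)\,Z_m(4-x),$$ and for every integer $k \ge 2$ $$Z_{2^k m}(x) = Z_{2^{k-1}m}(x)\, Z_m\bigl(\Phi_{2^k}(x)\bigr).$$
   Context: The polynomials $l_n(x)$ are defined by $l_0(x)=2$, $l_1(x)=x$, $l_n(x) = xl_{n-1}(x) - l_{n-2}(x)$ for $n\ge2$, and $Z_n(x) = 2 - l_n(2-x)$ (equivalently $Z_n(x)=4S_n(x/4)$ with $S_n$ the spread polynomials). For $n\ge 1$ let $\phi_n(x)$ be the minimal polynomial over $\mathbb{Q}$ of $4\sin^2(\pi/n)$. Set $\Phi_1(x)=x$, $\Phi_2(x)=x-4$, and $\Phi_n(x)=\phi_n(x)^2$ for $n\ge 3$; these satisfy $(-1)^{n-1}Z_n(x)=\prod_{d\mid n}\Phi_d(x)$. *)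

theory Defs
  imports
    Complex_Main
    "HOL-Computational_Algebra.Polynomial"
begin

fun l_poly :: "nat \<Rightarrow> rat poly" where
  "l_poly 0 = [:2:]"
| "l_poly (Suc 0) = [:0, 1:]"
| "l_poly (Suc (Suc n)) = [:0, 1:] * l_poly (Suc n) - l_poly n"

definition Z_poly :: "nat \<Rightarrow> rat poly" where
  "Z_poly n = [:2:] - l_poly n \<circ>\<^sub>p [:2, -1:]"

abbreviation poly_real :: "rat poly \<Rightarrow> real \<Rightarrow> real" where
  "poly_real p a \<equiv> poly (map_poly of_rat p) a"

definition is_min_poly_rat :: "real \<Rightarrow> rat poly \<Rightarrow> bool" where
  "is_min_poly_rat a p \<longleftrightarrow>
     lead_coeff p = 1 \<and> poly_real p a = 0 \<and>
     (\<forall>q. q \<noteq> 0 \<and> poly_real q a = 0 \<longrightarrow> degree p \<le> degree q)"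

(* Unspecified if a is transcendental. *)
definition min_poly_rat :: "real \<Rightarrow> rat poly" where
  "min_poly_rat a = (THE p. is_min_poly_rat a p)"

definition phi_poly :: "nat \<Rightarrow> rat poly" where
  "phi_poly n = min_poly_rat (4 * (sin (pi / real n))\<^sup>2)"

(* Meaningful for n > 0 only. *)
definition Phi_poly :: "nat \<Rightarrow> rat poly" where
  "Phi_poly n =
     (if n = 1 then [:0, 1:] else if n = 2 then [:-4, 1:] else (phi_poly n)\<^sup>2)"

lemma poly_real_add: "poly_real (p + q) a = poly_real p a + poly_real q a"
proof -
  have "map_poly of_rat (p + q) = map_poly of_rat p + (map_poly of_rat q :: real poly)"
    by (rule poly_eqI) (simp add: coeff_map_poly of_rat_add)
  then show ?thesis by simp
qed

lemma poly_real_diff: "poly_real (p - q) a = poly_real p a - poly_real q a"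
proof -
  have "map_poly of_rat (p - q) = map_poly of_rat p - (map_poly of_rat q :: real poly)"
    by (rule poly_eqI) (simp add: coeff_map_poly of_rat_diff)
  then show ?thesis by simp
qed

lemma poly_real_smult: "poly_real (smult c p) a = of_rat c * poly_real p a"
proof -
  have "map_poly of_rat (smult c p) = smult (of_rat c) (map_poly of_rat p :: real poly)"
    by (rule poly_eqI) (simp add: coeff_map_poly of_rat_mult)
  then show ?thesis by simp
qed

lemma poly_real_pCons: "poly_real (pCons c p) a = of_rat c + a * poly_real p a"
proof -
  have "map_poly of_rat (pCons c p) = pCons (of_rat c) (map_poly of_rat p :: real poly)"
    by (rule poly_eqI) (simp add: coeff_map_poly coeff_pCons split: nat.splits)
  then show ?thesis by simp
qed

lemma poly_real_mult: "poly_real (p * q) a = poly_real p a * poly_real q a"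
  by (induction p) (simp_all add: poly_real_add poly_real_smult poly_real_pCons algebra_simps)

lemma poly_real_pcompose: "poly_real (p \<circ>\<^sub>p q) a = poly_real p (poly_real q a)"
  by (induction p) (simp_all add: pcompose_pCons poly_real_add poly_real_mult poly_real_pCons)

lemma poly_real_l_poly_cos: "poly_real (l_poly n) (2 * cos t) = 2 * cos (real n * t)"
proof (induction n rule: l_poly.induct)
  case (3 n)
  have "cos (real (Suc (Suc n)) * t) + cos (real n * t) = 2 * cos t * cos (real (Suc n) * t)"
    using cos_plus_cos[of "real (Suc (Suc n)) * t" "real n * t"]
    by (simp add: algebra_simps add_divide_distrib)
  with 3 show ?case
    by (simp add: poly_real_diff poly_real_add poly_real_smult poly_real_mult poly_real_pCons algebra_simps)
qed (simp_all add: poly_real_pCons)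

lemma poly_real_Z_poly_sin:
  "poly_real (Z_poly n) (4 * (sin t)\<^sup>2) = 4 * (sin (real n * t))\<^sup>2"
proof -
  have *: "2 - 4 * (sin t)\<^sup>2 = 2 * cos (2 * t)" for t :: real
    by (simp add: cos_double_sin)
  have "poly_real (Z_poly n) (4 * (sin t)\<^sup>2)
          = 2 - poly_real (l_poly n) (2 - 4 * (sin t)\<^sup>2)"
    by (simp add: Z_poly_def poly_real_diff poly_real_pcompose poly_real_pCons of_rat_minus)
  also have "\<dots> = 2 - 2 * cos (2 * (real n * t))"
    unfolding * poly_real_l_poly_cos by (simp add: mult_ac)
  also have "\<dots> = 4 * (sin (real n * t))\<^sup>2"
    using *[of "real n * t"] by simp
  finally show ?thesis .
qed

lemma is_min_poly_rat_unique:
  assumes p: "is_min_poly_rat a p" and q: "is_min_poly_rat a q"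
  shows "p = q"
proof (rule ccontr)
  assume "p \<noteq> q"
  have "p \<noteq> 0" "q \<noteq> 0"
    using p q by (auto simp: is_min_poly_rat_def)
  then have deg: "degree p = degree q"
    using p q by (auto simp: is_min_poly_rat_def intro!: antisym)
  have "poly_real (p - q) a = 0"
    using p q by (simp add: is_min_poly_rat_def poly_real_diff)
  with p \<open>p \<noteq> q\<close> have le: "degree p \<le> degree (p - q)"
    by (simp add: is_min_poly_rat_def)
  have "coeff (p - q) (degree p) = 0"
    using p q deg by (simp add: is_min_poly_rat_def)
  moreover have "degree (p - q) \<le> degree p"
    using deg by (metis degree_diff_le order_refl)
  ultimately have "lead_coeff (p - q) = 0"
    using le by simp
  then have "p - q = 0"
    by (rule iffD1[OF leading_coeff_0_iff])
  with \<open>p \<noteq> q\<close> show False by simp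
qed

lemma is_min_poly_rat_exists:
  assumes "q \<noteq> 0" "poly_real q a = 0"
  shows "\<exists>p. is_min_poly_rat a p"
proof -
  obtain p where p: "p \<noteq> 0" "poly_real p a = 0"
    and min: "\<And>r. r \<noteq> 0 \<Longrightarrow> poly_real r a = 0 \<Longrightarrow> degree p \<le> degree r"
    using ex_has_least_nat[of "\<lambda>p. p \<noteq> 0 \<and> poly_real p a = 0" q degree] assms by blast
  have "is_min_poly_rat a (smult (inverse (lead_coeff p)) p)"
    using p min by (simp add: is_min_poly_rat_def poly_real_smult)
  then show ?thesis ..
qed

lemma is_min_poly_rat_phi_poly:
  assumes "n > 0"
  shows "is_min_poly_rat (4 * (sin (pi / real n))\<^sup>2) (phi_poly n)"
proof -
  have "poly_real (Z_poly n) (4 * (sin (pi / 2 / real n))\<^sup>2) \<noteq> 0"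
    unfolding poly_real_Z_poly_sin using assms by simp
  then have "Z_poly n \<noteq> 0" by auto
  moreover have "poly_real (Z_poly n) (4 * (sin (pi / real n))\<^sup>2) = 0"
    unfolding poly_real_Z_poly_sin using assms by simp
  ultimately have "\<exists>!p. is_min_poly_rat (4 * (sin (pi / real n))\<^sup>2) p"
    using is_min_poly_rat_exists is_min_poly_rat_unique by metis
  then show ?thesis
    unfolding phi_poly_def min_poly_rat_def by (rule theI')
qed

end

theory Submission
  imports Defs
begin

text \<open>
  Everything is an identity of polynomials on the values \<open>x = 4 sin\<^sup>2 t\<close>, where
  \<open>Z\<^sub>n(x) = 4 sin\<^sup>2 (n t)\<close>. Put \<open>r = 2\<^sup>k\<^sup>-\<^sup>1\<close>. Doubling the angle in
  \<open>4 sin\<^sup>2 (2 r m t)\<close> splits off the factor \<open>4 cos\<^sup>2 (r m t)\<close>, which for odd \<open>m\<close> is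
  \<open>Z\<^sub>m(4 cos\<^sup>2 (r t))\<close>. So it remains to see that \<open>\<Phi>(x) = 4 cos\<^sup>2 (r t)\<close> for \<open>\<Phi> = \<Phi>\<^sub>2\<^sub>r\<close>
  (and \<open>\<Phi> = - \<Phi>\<^sub>2\<close> if \<open>k = 1\<close>).
  For \<open>k \<ge> 2\<close>, the integer polynomial \<open>g\<close> with \<open>g(x) = 2 cos (r t)\<close> has the root \<open>4 sin\<^sup>2 (\<pi> / 2\<^sup>k)\<close> and
  satisfies Eisenstein's criterion at 2, so up to sign it is the minimal polynomial of
  that root.
\<close>

section \<open>Eisenstein's criterion\<close>

lemma map_poly_of_int_smult:
  "map_poly of_int (smult c p) = smult (of_int c) (map_poly of_int p :: rat poly)"
  by (rule poly_eqI) (simp add: coeff_map_poly)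

lemma map_poly_of_int_mult:
  "map_poly of_int (p * q) = (map_poly of_int p * map_poly of_int q :: rat poly)"
  by (rule poly_eqI) (simp add: coeff_map_poly coeff_mult)

lemma map_poly_of_int_pCons:
  "map_poly of_int (pCons c p) = (pCons (of_int c) (map_poly of_int p) :: rat poly)"
  by (rule poly_eqI) (simp add: coeff_map_poly coeff_pCons split: nat.splits)

lemma map_poly_of_int_eq_iff:
  "(map_poly of_int p :: rat poly) = map_poly of_int q \<longleftrightarrow> p = q"
  by (simp add: poly_eq_iff coeff_map_poly)

lemma rat_poly_clear_denominators:
  fixes p :: "rat poly"
  obtains d :: int and q :: "int poly"
  where "d \<noteq> 0" "smult (of_int d) p = map_poly of_int q"
proof -
  have "\<exists>d q. (d::int) \<noteq> 0 \<and> smult (of_int d) p = map_poly of_int q"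
  proof (induction p)
    case 0
    show ?case by (rule exI[of _ 1], rule exI[of _ 0]) simp
  next
    case (pCons a p)
    then obtain d q where dq: "d \<noteq> 0" "smult (of_int d) p = map_poly of_int q" by blast
    obtain n e :: int where ne: "e \<noteq> 0" "a = of_int n / of_int e"
      by (metis Fract_of_int_quotient Rat_cases less_irrefl)
    have "smult (of_int (e * d)) (pCons a p) = map_poly of_int (pCons (n * d) (smult e q))"
      using ne by (simp add: map_poly_of_int_pCons map_poly_of_int_smult flip: dq(2))
    with ne dq show ?case by (metis mult_eq_0_iff)
  qed
  then show thesis using that by blast
qed

text \<open>Clear denominators, then pull out the content; both scalars stay integers so that
  contents can be compared later.\<close>

lemma rat_poly_primitive_int_poly:
  fixes p :: "rat poly"
  assumes "p \<noteq> 0"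
  obtains d c :: int and q :: "int poly"
  where "d \<noteq> 0" "content q = 1" "smult (of_int d) p = smult (of_int c) (map_poly of_int q)"
proof -
  obtain d q where dq: "d \<noteq> 0" "smult (of_int d) p = map_poly of_int q"
    using rat_poly_clear_denominators .
  have "q \<noteq> 0" using dq assms by auto
  then have "content (primitive_part q) = 1" by simp
  moreover have "map_poly of_int q
      = smult (of_int (content q)) (map_poly of_int (primitive_part q) :: rat poly)"
    by (simp flip: map_poly_of_int_smult)
  ultimately show thesis using that dq by metis
qed

text \<open>Gauss's lemma: contents multiply, so comparing them in the cleared equation makes the
  two scalars agree up to sign. The sign is absorbed into \<open>q'\<close>.\<close>

lemma gauss_lemma_factorization:
  fixes f :: "int poly" and q r :: "rat poly"
  assumes f: "content f = 1" and qr: "map_poly of_int f = q * r"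
  obtains q' r' where "f = q' * r'" "degree q' = degree q" "degree r' = degree r"
proof -
  have "f \<noteq> 0" using f by auto
  then have nz: "q \<noteq> 0" "r \<noteq> 0" using qr map_poly_of_int_eq_iff[of f 0] by auto
  obtain d c q' where q': "d \<noteq> 0" "content q' = 1"
    "smult (of_int d) q = smult (of_int c) (map_poly of_int q')"
    using rat_poly_primitive_int_poly[OF nz(1)] .
  obtain e b r' where r': "e \<noteq> 0" "content r' = 1"
    "smult (of_int e) r = smult (of_int b) (map_poly of_int r')"
    using rat_poly_primitive_int_poly[OF nz(2)] .
  have cb: "c \<noteq> 0" "b \<noteq> 0" using q' r' nz by auto
  have deg: "degree q' = degree q" "degree r' = degree r"
    using arg_cong[OF q'(3), of degree] arg_cong[OF r'(3), of degree] q'(1) r'(1) cb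
    by (simp_all add: degree_map_poly)
  have "map_poly of_int (smult (d * e) f) = smult (of_int d) q * smult (of_int e) r"
    by (simp add: map_poly_of_int_smult qr mult_ac)
  also have "\<dots> = map_poly of_int (smult (c * b) (q' * r'))"
    unfolding q' r' by (simp add: map_poly_of_int_smult map_poly_of_int_mult mult_ac)
  finally have eq: "smult (d * e) f = smult (c * b) (q' * r')"
    unfolding map_poly_of_int_eq_iff .
  have "\<bar>d * e\<bar> = \<bar>c * b\<bar>"
    using arg_cong[OF eq, of content] f q'(2) r'(2) by (simp add: content_mult)
  then consider "c * b = d * e" | "c * b = - (d * e)" by linarith
  then show thesis
  proof cases
    case 1
    then have "smult (d * e) (f - q' * r') = 0" using eq by (simp add: smult_diff_right)
    then have "f = q' * r'" using q' r' by simp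
    with deg that show thesis by blast
  next
    case 2
    then have "smult (d * e) (f + q' * r') = 0" using eq by (simp add: smult_add_right)
    then have "f = (- q') * r'" using q' r' by (simp add: add_eq_0_iff2)
    with deg that[of "- q'" r'] show thesis by simp
  qed
qed

text \<open>At the least \<open>i\<close> with \<open>coeff q i\<close> not divisible by
  \<open>p\<close>, every term of \<open>coeff (q * r) i\<close> except
  \<open>coeff q i * coeff r 0\<close> is divisible by \<open>p\<close>. Hence
  \<open>degree (q * r) \<le> i \<le> degree q\<close>.\<close>

lemma eisenstein_factor:
  fixes q r :: "int poly"
  assumes p: "prime p"
    and lead: "\<not> p dvd lead_coeff (q * r)"
    and lower: "\<And>i. i < degree (q * r) \<Longrightarrow> p dvd coeff (q * r) i"
    and q0: "p dvd coeff q 0" and r0: "\<not> p dvd coeff r 0"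
  shows "degree r = 0"
proof -
  have nz: "q \<noteq> 0" "r \<noteq> 0" using lead by auto
  have "\<not> p dvd lead_coeff q" using lead by (auto simp: lead_coeff_mult)
  define i where "i = (LEAST i. \<not> p dvd coeff q i)"
  have i: "\<not> p dvd coeff q i" unfolding i_def by (rule LeastI) fact
  have less: "p dvd coeff q j" if "j < i" for j
    using not_less_Least[of j "\<lambda>i. \<not> p dvd coeff q i"] that unfolding i_def by blast
  have "i \<le> degree q" unfolding i_def by (rule Least_le) fact
  have "coeff (q * r) i = (\<Sum>j<i. coeff q j * coeff r (i - j)) + coeff q i * coeff r 0"
    by (simp add: coeff_mult flip: lessThan_Suc_atMost)
  moreover have "p dvd (\<Sum>j<i. coeff q j * coeff r (i - j))"
    by (intro dvd_sum dvd_mult2 less) simp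
  moreover have "\<not> p dvd coeff q i * coeff r 0"
    using i r0 p by (simp add: prime_dvd_mult_iff)
  ultimately have "\<not> p dvd coeff (q * r) i"
    by (simp add: dvd_add_right_iff)
  then have "degree (q * r) \<le> i" using lower by (meson not_less)
  with \<open>i \<le> degree q\<close> nz show ?thesis by (simp add: degree_mult_eq)
qed

lemma eisenstein_criterion:
  fixes f :: "int poly" and q r :: "rat poly"
  assumes f: "content f = 1" and p: "prime p"
    and lead: "\<not> p dvd lead_coeff f"
    and lower: "\<And>i. i < degree f \<Longrightarrow> p dvd coeff f i"
    and const: "\<not> p\<^sup>2 dvd coeff f 0"
    and qr: "map_poly of_int f = q * r"
  shows "degree q = 0 \<or> degree r = 0"
proof (cases "degree f = 0")
  case True
  have "degree (q * r) = 0" using True by (simp add: degree_map_poly flip: qr)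
  moreover have "q * r \<noteq> 0"
    using f map_poly_of_int_eq_iff[of f 0] by (auto simp flip: qr)
  ultimately show ?thesis by (auto simp: degree_mult_eq)
next
  \<comment> \<open>Positive degree puts index 0 in the range of \<open>lower\<close>; since
    \<open>p\<^sup>2\<close> does not divide the constant coefficient, \<open>p\<close> divides that
    of exactly one factor.\<close>
  case False
  obtain s t where st: "f = s * t" "degree s = degree q" "degree t = degree r"
    using gauss_lemma_factorization[OF f qr] .
  have c0: "coeff f 0 = coeff s 0 * coeff t 0" by (simp add: st coeff_mult)
  then have "p dvd coeff s 0 \<or> p dvd coeff t 0"
    using lower[of 0] False p by (simp add: prime_dvd_mult_iff)
  moreover have "\<not> (p dvd coeff s 0 \<and> p dvd coeff t 0)"
    using const unfolding c0 power2_eq_square by (auto intro: mult_dvd_mono)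
  ultimately show ?thesis
    using eisenstein_factor[of p s t] eisenstein_factor[of p t s] p lead lower st
    by (auto simp: mult.commute)
qed

section \<open>Minimal polynomials\<close>

text \<open>The remainder of \<open>q\<close> modulo \<open>p\<close> also vanishes at
  \<open>a\<close>, so minimality of the degree forces it to be 0.\<close>

lemma is_min_poly_rat_dvd:
  assumes p: "is_min_poly_rat a p" and q: "poly_real q a = 0"
  shows "p dvd q"
proof -
  have "p \<noteq> 0" using p by (auto simp: is_min_poly_rat_def)
  have "poly_real (q div p * p + q mod p) a = 0" using q by simp
  then have "poly_real (q mod p) a = 0"
    using p unfolding poly_real_add poly_real_mult by (simp add: is_min_poly_rat_def)
  then have "q mod p = 0"
    using p degree_mod_less'[of p q] \<open>p \<noteq> 0\<close>
    by (meson is_min_poly_rat_def not_le)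
  then show ?thesis by auto
qed

lemma is_min_poly_rat_degree_pos:
  assumes "is_min_poly_rat a p"
  shows "degree p > 0"
proof (rule ccontr)
  assume "\<not> degree p > 0"
  with assms have "p = 1"
    by (auto simp: is_min_poly_rat_def one_pCons elim!: degree_eq_zeroE)
  with assms show False by (simp add: is_min_poly_rat_def)
qed

section \<open>The minimal polynomial of \<open>4 sin\<^sup>2 (\<pi> / 2\<^sup>k)\<close>\<close>

text \<open>This is \<open>l\<^sub>n(2 - x)\<close> for \<open>n = 2\<^sup>j\<close>.\<close>

fun dyadic_poly :: "nat \<Rightarrow> int poly" where
  "dyadic_poly 0 = [:2, -1:]"
| "dyadic_poly (Suc j) = (dyadic_poly j)\<^sup>2 - [:2:]"

text \<open>The recursion is the double-angle formula for \<open>2 * cos\<close>. The exponent is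
  \<open>Suc j\<close> because \<open>2 - 4 * (sin t)\<^sup>2\<close> is already
  \<open>2 * cos (2 * t)\<close>.\<close>

lemma poly_real_dyadic_poly:
  "poly_real (map_poly of_int (dyadic_poly j)) (4 * (sin t)\<^sup>2) = 2 * cos (2 ^ Suc j * t)"
proof (induction j)
  case 0
  show ?case by (simp add: map_poly_of_int_pCons poly_real_pCons of_rat_minus cos_double_sin)
next
  case (Suc j)
  have "map_poly of_int (dyadic_poly (Suc j))
      = map_poly of_int (dyadic_poly j) * map_poly of_int (dyadic_poly j) - ([:2:] :: rat poly)"
    by (rule poly_eqI)
       (simp add: coeff_map_poly coeff_pCons power2_eq_square split: nat.splits
             flip: map_poly_of_int_mult)
  then show ?case
    using Suc cos_double_cos[of "2 ^ Suc j * t"]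
    by (simp add: poly_real_diff poly_real_mult poly_real_pCons power2_eq_square mult_ac)
qed

text \<open>Proved jointly: the degree step needs a nonzero polynomial, the leading coefficient step
  needs the degree. The absolute value covers the sign -1 at \<open>j = 0\<close>.\<close>

lemma degree_dyadic_poly: "degree (dyadic_poly j) = 2 ^ j"
  and lead_coeff_dyadic_poly: "\<bar>lead_coeff (dyadic_poly j)\<bar> = 1"
proof (induction j)
  case (Suc j)
  case 1
  have "dyadic_poly j \<noteq> 0"
    using Suc(2) by auto
  have sq: "degree ((dyadic_poly j)\<^sup>2) = 2 ^ Suc j"
    using Suc(1) \<open>dyadic_poly j \<noteq> 0\<close> by (simp add: degree_power_eq)
  have *: "degree (- [:2:] :: int poly) < degree ((dyadic_poly j)\<^sup>2)"
    unfolding sq by simp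
  show deg: ?case
    using degree_add_eq_left[OF *] sq by (simp only: dyadic_poly.simps diff_conv_add_uminus)
  case 2
  have "lead_coeff (dyadic_poly (Suc j)) = (lead_coeff (dyadic_poly j))\<^sup>2"
    using deg sq by (simp add: coeff_eq_0 flip: lead_coeff_power)
  with Suc(2) show ?case by (simp add: power_abs)
qed simp_all

lemma coeff_0_dyadic_poly: "coeff (dyadic_poly j) 0 = 2"
  by (induction j) (simp_all flip: poly_0_coeff_0)

text \<open>Modulo 2 the recursion is plain squaring. This makes all coefficients below the leading
  one even, as Eisenstein's criterion requires.\<close>

lemma dyadic_poly_mod_2: "[:2:] dvd dyadic_poly j - monom 1 (2 ^ j)"
proof (induction j)
  case 0
  have "dyadic_poly 0 - monom 1 (2 ^ 0) = [:2:] * [:1, -1:]"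
    by (simp add: monom_Suc one_pCons)
  then show ?case by (metis dvd_triv_left)
next
  case (Suc j)
  have "dyadic_poly (Suc j) - monom 1 (2 ^ Suc j)
      = (dyadic_poly j - monom 1 (2 ^ j)) * (dyadic_poly j + monom 1 (2 ^ j)) - [:2:]"
    by (simp add: algebra_simps power2_eq_square mult_monom mult_2)
  then show ?case using Suc by (simp only: dvd_diff dvd_mult2 dvd_refl)
qed

lemma dyadic_poly_irreducible:
  assumes "map_poly of_int (dyadic_poly j) = (q * r :: rat poly)"
  shows "degree q = 0 \<or> degree r = 0"
proof (rule eisenstein_criterion[OF _ _ _ _ _ assms, where p = 2])
  \<comment> \<open>The leading coefficient is a unit, which forces content 1.\<close>
  have "content (dyadic_poly j) dvd lead_coeff (dyadic_poly j)" by simp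
  moreover have unit: "is_unit (lead_coeff (dyadic_poly j))"
    using lead_coeff_dyadic_poly by simp
  ultimately have "is_unit (content (dyadic_poly j))" by (rule dvd_trans)
  then show "content (dyadic_poly j) = 1"
    by (metis is_unit_normalize normalize_content)
  show "\<not> 2 dvd lead_coeff (dyadic_poly j)"
    using unit by (meson dvd_trans not_is_unit_0 odd_one)
  show "2 dvd coeff (dyadic_poly j) i" if "i < degree (dyadic_poly j)" for i
    using dyadic_poly_mod_2[of j] that unfolding const_poly_dvd_iff
    by (auto simp: degree_dyadic_poly dest: spec[of _ i])
qed (simp_all add: coeff_0_dyadic_poly)

lemma Phi_poly_power_2:
  "Phi_poly (2 ^ Suc (Suc j)) = (map_poly of_int (dyadic_poly j))\<^sup>2"
proof -
  define G :: "rat poly" where "G = map_poly of_int (dyadic_poly j)"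
  define n :: nat where "n = 2 ^ Suc (Suc j)"
  have "n > 0" "n \<noteq> 1" "n \<noteq> 2" by (simp_all add: n_def)
  have min: "is_min_poly_rat (4 * (sin (pi / real n))\<^sup>2) (phi_poly n)"
    using \<open>n > 0\<close> by (rule is_min_poly_rat_phi_poly)
  \<comment> \<open>So \<open>G\<close> takes the value \<open>2 * cos (pi / 2) = 0\<close> at this
    point and is a multiple of \<open>phi_poly n\<close>.\<close>
  have "2 ^ Suc j * (pi / real n) = pi / 2" by (simp add: n_def)
  then have "poly_real G (4 * (sin (pi / real n))\<^sup>2) = 0"
    unfolding G_def poly_real_dyadic_poly by (simp only: cos_pi_half mult_zero_right)
  then obtain r where r: "G = phi_poly n * r"
    using is_min_poly_rat_dvd[OF min] by (auto elim: dvdE)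
  then have "degree r = 0"
    using dyadic_poly_irreducible[of j "phi_poly n" r] is_min_poly_rat_degree_pos[OF min]
    by (simp add: G_def)
  then obtain c where c: "r = [:c:]" by (rule degree_eq_zeroE)
  have "lead_coeff G = c"
    using min unfolding r c lead_coeff_mult by (simp add: is_min_poly_rat_def)
  moreover have "\<bar>lead_coeff G\<bar> = 1"
    using arg_cong[OF lead_coeff_dyadic_poly[of j], of "of_int :: int \<Rightarrow> rat"]
    by (simp add: G_def degree_map_poly coeff_map_poly)
  \<comment> \<open>\<open>phi_poly n\<close> is monic, so \<open>G\<close> differs from it only by
    the sign \<open>c\<close>, which squaring removes.\<close>
  ultimately have "c\<^sup>2 = 1" by (simp add: abs_square_eq_1)
  then have "G\<^sup>2 = (phi_poly n)\<^sup>2"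
    unfolding r c by (simp add: power2_eq_square)
  then show ?thesis
    using \<open>n \<noteq> 1\<close> \<open>n \<noteq> 2\<close> by (simp add: Phi_poly_def G_def n_def)
qed

section \<open>The factorization\<close>

text \<open>The values \<open>4 * (sin t)\<^sup>2\<close> fill the interval from 0 to 4, and a
  nonzero polynomial has only finitely many roots.\<close>

lemma rat_poly_eqI_sin:
  assumes "\<And>t. poly_real p (4 * (sin t)\<^sup>2) = poly_real q (4 * (sin t)\<^sup>2)"
  shows "p = q"
proof -
  have "{0..4} \<subseteq> {x. poly (map_poly of_rat (p - q)) x = (0 :: real)}"
  proof
    fix x :: real assume "x \<in> {0..4}"
    then have "4 * (sin (arcsin (sqrt (x / 4))))\<^sup>2 = x"
      by (subst sin_arcsin) (auto intro: order_trans[of _ 0])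
    then show "x \<in> {x. poly (map_poly of_rat (p - q)) x = (0 :: real)}"
      using assms by (metis (mono_tags) mem_Collect_eq poly_real_diff right_minus_eq)
  qed
  then have "map_poly of_rat (p - q) = (0 :: real poly)"
    using poly_roots_finite infinite_Icc[of "0 :: real" 4]
    by (metis finite_subset zero_less_numeral)
  then show ?thesis by (simp add: poly_eq_iff coeff_map_poly)
qed

text \<open>Replace \<open>t\<close> by \<open>pi / 2 - t\<close> in the sine formula; for odd
  \<open>m\<close> this turns sine into cosine up to a sign, lost in the square.\<close>

lemma poly_real_Z_poly_cos:
  assumes "odd m"
  shows "poly_real (Z_poly m) (4 * (cos t)\<^sup>2) = 4 * (cos (real m * t))\<^sup>2"
proof -
  obtain i where "m = 2 * i + 1" using assms by (auto elim: oddE)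
  then have "real m * (pi / 2 - t) = real i * pi + (pi / 2 - real m * t)"
    by (simp add: field_simps)
  then have "(sin (real m * (pi / 2 - t)))\<^sup>2 = (cos (real m * t))\<^sup>2"
    by (simp add: sin_add sin_diff power_mult_distrib flip: power_mult)
  then show ?thesis
    using poly_real_Z_poly_sin[of m "pi / 2 - t"] by (simp add: sin_diff)
qed

text \<open>Covers both claims: \<open>r = 1\<close> with \<open>P = - Phi_poly 2\<close>, and
  \<open>r = 2 ^ (k - 1)\<close> with \<open>P = Phi_poly (2 ^ k)\<close>.\<close>

lemma Z_poly_double:
  assumes "odd m" and P: "\<And>t. poly_real P (4 * (sin t)\<^sup>2) = 4 * (cos (real r * t))\<^sup>2"
  shows "Z_poly (2 * r * m) = Z_poly (r * m) * (Z_poly m \<circ>\<^sub>p P)"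
proof (rule rat_poly_eqI_sin)
  fix t
  have "(sin (real (2 * r * m) * t))\<^sup>2
      = 4 * (sin (real (r * m) * t))\<^sup>2 * (cos (real m * (real r * t)))\<^sup>2"
    using sin_double[of "real (r * m) * t"] by (simp add: power_mult_distrib mult_ac)
  then show "poly_real (Z_poly (2 * r * m)) (4 * (sin t)\<^sup>2)
      = poly_real (Z_poly (r * m) * (Z_poly m \<circ>\<^sub>p P)) (4 * (sin t)\<^sup>2)"
    by (simp only: poly_real_mult poly_real_pcompose P poly_real_Z_poly_sin
        poly_real_Z_poly_cos[OF \<open>odd m\<close>])
qed

theorem theorem3:
  fixes m :: nat
  assumes "odd m"
  shows "Z_poly (2 * m) = Z_poly m * (Z_poly m \<circ>\<^sub>p (- Phi_poly 2)) \<and>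
         Z_poly m * (Z_poly m \<circ>\<^sub>p (- Phi_poly 2)) = Z_poly m * (Z_poly m \<circ>\<^sub>p [:4, -1:]) \<and>
         (\<forall>k::nat. k \<ge> 2 \<longrightarrow>
            Z_poly (2 ^ k * m) = Z_poly (2 ^ (k - 1) * m) * (Z_poly m \<circ>\<^sub>p Phi_poly (2 ^ k)))"
proof (intro conjI allI impI)
  have neg_Phi_2: "- Phi_poly 2 = [:4, -1:]" by (simp add: Phi_poly_def)
  then show "Z_poly m * (Z_poly m \<circ>\<^sub>p (- Phi_poly 2)) = Z_poly m * (Z_poly m \<circ>\<^sub>p [:4, -1:])"
    by simp
  have "poly_real [:4, -1:] (4 * (sin t)\<^sup>2) = 4 * (cos (real 1 * t))\<^sup>2" for t
    by (simp add: poly_real_pCons of_rat_minus cos_squared_eq)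
  from Z_poly_double[OF assms this]
  show "Z_poly (2 * m) = Z_poly m * (Z_poly m \<circ>\<^sub>p (- Phi_poly 2))"
    by (simp add: neg_Phi_2)
next
  fix k :: nat assume "k \<ge> 2"
  then obtain j where k: "k = Suc (Suc j)"
    by (metis add_2_eq_Suc le_Suc_ex)
  have "poly_real (Phi_poly (2 ^ k)) (4 * (sin t)\<^sup>2) = 4 * (cos (real (2 ^ Suc j) * t))\<^sup>2" for t
    unfolding k Phi_poly_power_2 power2_eq_square[of "map_poly _ _"] poly_real_mult
      poly_real_dyadic_poly by (simp add: power2_eq_square)
  from Z_poly_double[OF assms this]
  show "Z_poly (2 ^ k * m) = Z_poly (2 ^ (k - 1) * m) * (Z_poly m \<circ>\<^sub>p Phi_poly (2 ^ k))"
    by (simp add: k)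
qed

end
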